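(* Let $\xi>0$ be fixed, let $e:=(0,0,0)\in\mathbb{R}^2\times S^1$, and let $\mathcal{S}\subseteq\mathbb{R}^2\times S^1$ be the set of final conditions $q_{fin}=(x_{fin},y_{fin},\theta_{fin})$ for which a solution (global minimizer) of the problem $\mathbf{(P_{curve})}$ from $e$ to $q_{fin}$ exists. Then $\mathcal{S}$ is arc-connected and non-compact.
   Context: Here $S^1=\mathbb{R}/2\pi\mathbb{Z}$. "Arc-connected" means that any two points of $\mathcal S$ are joined by a continuous path in $\mathcal S$. Problem $\mathbf{(P_{curve})}$ from $q_{in}$ to $q_{fin}$ (with parameter $\xi>0$): among all $\ell\ge 0$ (the length $\ell$ is free), all integrable controls $v\in L^1([0,\ell],\mathbb{R})$ and all absolutely continuous curves $q=(x,y,\theta):[0,\ell]\to\mathbb{R}^2\times S^1$ satisfying, for a.e. $s$, $$\frac{dx}{ds}=\cos\theta(s),\qquad \frac{dy}{ds}=\sin\theta(s),\qquad \frac{d\theta}{ds}=v(s),$$ with $q(0)=q_{in}$ and $q(\ell)=q_{fin}$, minimize the cost $\int_0^\ell\sqrt{\xi^2+v(s)^2}\,ds$. A solution is a pair $(q,v)$ attaining the minimum. *)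

theory Defs
  imports "HOL-Analysis.Analysis" "HOL-Library.Real_Mod"
begin

quotient_type circle = real / "\<lambda>x y. [x = y] (rmod (2 * pi))"
  morphisms rep_circle angle
  by (intro equivpI reflpI sympI transpI) (auto intro: rcong_sym rcong_trans)

lemma angle_eq_iff: "angle a = angle b \<longleftrightarrow> (\<exists>n::int. b = a + of_int n * (2 * pi))"
  by (simp add: circle.abs_eq_iff rcong_altdef)

lemma angle_surj: "\<exists>a. p = angle a"
  by (metis Quotient3_abs_rep Quotient3_circle)

lift_definition circle_cos :: "circle \<Rightarrow> real" is cos
  by (metis cis.sel(1) cis_eq_iff)

lift_definition circle_sin :: "circle \<Rightarrow> real" is sin
  by (rule sin_rcong)

text \<open>
  The distance is the length of the shortest arc, i.e. the distance of two cosets in the reals.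
  Lemma \<open>open_circle_iff\<close> below shows that it induces the quotient topology.
\<close>

instantiation circle :: metric_space
begin

definition dist_circle :: "circle \<Rightarrow> circle \<Rightarrow> real" where
  "dist_circle p q = Inf {\<bar>a - b\<bar> | a b. p = angle a \<and> q = angle b}"

definition uniformity_circle :: "(circle \<times> circle) filter" where
  "uniformity_circle = (INF e\<in>{0<..}. principal {(x, y). dist x y < e})"

definition open_circle :: "circle set \<Rightarrow> bool" where
  "open_circle U \<longleftrightarrow> (\<forall>x\<in>U. \<forall>\<^sub>F (x', y) in uniformity. x' = x \<longrightarrow> y \<in> U)"

lemma dist_circle_le: "dist (angle a) (angle b) \<le> \<bar>a - b\<bar>"
  unfolding dist_circle_def
  by (rule cInf_lower) (auto intro!: bdd_belowI[of _ 0])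

lemma dist_circle_attained: "\<exists>b. q = angle b \<and> dist (angle a) q = \<bar>a - b\<bar>"
proof -
  obtain c where c: "q = angle c"
    using angle_surj by blast
  define x where "x = (a - c) / (2 * pi)"
  define b where "b = c + of_int (round x) * (2 * pi)"
  have qb: "q = angle b"
    unfolding c b_def angle_eq_iff by blast
  have min: "\<bar>a - b\<bar> \<le> \<bar>a' - b'\<bar>" if "angle a = angle a'" "q = angle b'" for a' b'
  proof -
    from that obtain m n :: int where
      "a' = a + of_int m * (2 * pi)" "b' = c + of_int n * (2 * pi)"
      unfolding c angle_eq_iff by blast
    then have "a' - b' = 2 * pi * (x - of_int (n - m))"
      by (simp add: x_def field_simps)
    moreover have "a - b = 2 * pi * (x - of_int (round x))"
      by (simp add: x_def b_def field_simps)
    moreover have "\<bar>x - of_int (round x)\<bar> \<le> \<bar>x - of_int (n - m)\<bar>"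
      by (rule round_diff_minimal)
    ultimately show ?thesis
      by (simp add: abs_mult)
  qed
  have "dist (angle a) q = \<bar>a - b\<bar>"
    unfolding dist_circle_def
    by (rule cInf_eq_minimum) (use qb min in auto)
  with qb show ?thesis by blast
qed

instance
proof
  fix p q r :: circle
  show "uniformity = (INF e\<in>{0<..}. principal {(x :: circle, y). dist x y < e})"
    by (rule uniformity_circle_def)
  show "open U \<longleftrightarrow> (\<forall>x\<in>U. \<forall>\<^sub>F (x', y) in uniformity. x' = x \<longrightarrow> y \<in> U)" for U :: "circle set"
    by (rule open_circle_def)
  obtain a where a: "p = angle a"
    using angle_surj by blast
  obtain b where b: "q = angle b" "dist p q = \<bar>a - b\<bar>"
    using dist_circle_attained a by blast
  show "dist p q = 0 \<longleftrightarrow> p = q"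
  proof
    assume "p = q"
    have "{\<bar>c - d\<bar> | c d. p = angle c \<and> q = angle d} \<noteq> {}"
      using a b by blast
    moreover have "dist p q \<le> 0"
      using dist_circle_le[of a a] a \<open>p = q\<close> by simp
    ultimately show "dist p q = 0"
      using b by simp
  qed (use a b in simp)
  obtain c where c: "r = angle c"
    using angle_surj by blast
  obtain a' where a': "p = angle a'" "dist r p = \<bar>c - a'\<bar>"
    using dist_circle_attained c by blast
  obtain b' where b': "q = angle b'" "dist r q = \<bar>c - b'\<bar>"
    using dist_circle_attained c by blast
  have sym: "dist u w = dist w u" for u w :: circle
    unfolding dist_circle_def by (rule arg_cong[of _ _ Inf]) (force simp: abs_minus_commute)
  have "dist p q \<le> \<bar>a' - b'\<bar>"
    using dist_circle_le a'(1) b'(1) by simp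
  also have "\<dots> \<le> dist r p + dist r q"
    unfolding a'(2) b'(2) by simp
  finally show "dist p q \<le> dist p r + dist q r"
    by (simp add: sym)
qed

end

lemma open_circle_iff: "open U \<longleftrightarrow> open (angle -` U)"
proof
  assume U: "open U"
  show "open (angle -` U)"
    unfolding open_dist
  proof
    fix a assume "a \<in> angle -` U"
    then obtain e where "e > 0" "\<forall>q. dist q (angle a) < e \<longrightarrow> q \<in> U"
      using U unfolding open_dist by auto
    then show "\<exists>e>0. \<forall>b. dist b a < e \<longrightarrow> b \<in> angle -` U"
      by (metis dist_circle_le dist_real_def le_less_trans vimageI)
  qed
next
  assume U: "open (angle -` U)"
  show "open U"
    unfolding open_dist
  proof
    fix p assume "p \<in> U"
    obtain a where a: "p = angle a"
      using angle_surj by blast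
    then obtain e where e: "e > 0" "\<forall>b. dist b a < e \<longrightarrow> b \<in> angle -` U"
      using U \<open>p \<in> U\<close> unfolding open_dist by auto
    have "q \<in> U" if "dist q p < e" for q
    proof -
      obtain b where "q = angle b" "dist p q = \<bar>a - b\<bar>"
        using dist_circle_attained a by blast
      then show ?thesis
        using e that by (auto simp: dist_real_def dist_commute abs_minus_commute)
    qed
    then show "\<exists>e>0. \<forall>q. dist q p < e \<longrightarrow> q \<in> U"
      using e by blast
  qed
qed

text \<open>
  The derivative of a circle-valued function is the derivative of a real-valued lift near the
  point.  A lift that is differentiable at \<open>s\<close> is continuous there, so this is the derivative in
  a local chart of the circle; it does not depend on the choice of the lift.
\<close>

definition has_angular_derivative :: "(real \<Rightarrow> circle) \<Rightarrow> real \<Rightarrow> real \<Rightarrow> real set \<Rightarrow> bool" where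
  "has_angular_derivative \<theta> w s S \<longleftrightarrow>
    (\<exists>\<phi>. \<theta> s = angle (\<phi> s) \<and> (\<forall>\<^sub>F t in at s within S. \<theta> t = angle (\<phi> t)) \<and>
         (\<phi> has_real_derivative w) (at s within S))"

definition absolutely_continuous_on :: "real set \<Rightarrow> (real \<Rightarrow> 'a::metric_space) \<Rightarrow> bool" where
  "absolutely_continuous_on S f \<longleftrightarrow>
    (\<forall>\<epsilon>>0. \<exists>\<delta>>0. \<forall>D :: (real \<times> real) set.
      finite D \<and> (\<forall>(a, b)\<in>D. a \<le> b \<and> {a..b} \<subseteq> S) \<and>
      disjoint_family_on (\<lambda>(a, b). {a<..<b}) D \<and> (\<Sum>(a, b)\<in>D. b - a) < \<delta> \<longrightarrow>
      (\<Sum>(a, b)\<in>D. dist (f a) (f b)) < \<epsilon>)"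

type_synonym config = "real \<times> real \<times> circle"

text \<open>
  Curves and controls on the interval from \<open>0\<close> to \<open>l\<close> are total functions on the reals; their
  values outside the interval are irrelevant.
\<close>

definition admissible ::
  "config \<Rightarrow> config \<Rightarrow> real \<Rightarrow> (real \<Rightarrow> config) \<Rightarrow> (real \<Rightarrow> real) \<Rightarrow> bool" where
  "admissible q_in q_fin l q v \<longleftrightarrow>
    0 \<le> l \<and> set_integrable lebesgue {0..l} v \<and> absolutely_continuous_on {0..l} q \<and>
    (AE s in lebesgue. s \<in> {0..l} \<longrightarrow>
      ((\<lambda>t. fst (q t)) has_real_derivative circle_cos (snd (snd (q s)))) (at s within {0..l}) \<and>
      ((\<lambda>t. fst (snd (q t))) has_real_derivative circle_sin (snd (snd (q s)))) (at s within {0..l}) \<and>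
      has_angular_derivative (\<lambda>t. snd (snd (q t))) (v s) s {0..l}) \<and>
    q 0 = q_in \<and> q l = q_fin"

definition cost :: "real \<Rightarrow> real \<Rightarrow> (real \<Rightarrow> real) \<Rightarrow> real" where
  "cost \<xi> l v = (LINT s:{0..l}|lebesgue. sqrt (\<xi>\<^sup>2 + (v s)\<^sup>2))"

definition is_solution ::
  "real \<Rightarrow> config \<Rightarrow> config \<Rightarrow> real \<Rightarrow> (real \<Rightarrow> config) \<Rightarrow> (real \<Rightarrow> real) \<Rightarrow> bool" where
  "is_solution \<xi> q_in q_fin l q v \<longleftrightarrow>
    admissible q_in q_fin l q v \<and>
    (\<forall>l' q' v'. admissible q_in q_fin l' q' v' \<longrightarrow> cost \<xi> l v \<le> cost \<xi> l' v')"

definition origin :: config where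
  "origin = (0, 0, angle 0)"

definition existence_set :: "real \<Rightarrow> config set" where
  "existence_set \<xi> = {q_fin. \<exists>l q v. is_solution \<xi> origin q_fin l q v}"

end

theory Submission
  imports Defs
begin

text \<open>
  Connectedness rests on the additivity of the cost under concatenation of curves.
  If \<open>q\<close> is a minimizer on \<open>{0..l}\<close> and \<open>s \<in> {0..l}\<close>, then \<open>q\<close> restricted to \<open>{0..s}\<close> is a
  minimizer towards \<open>q s\<close>: a cheaper competitor from the origin to \<open>q s\<close>, followed by the remaining
  part of \<open>q\<close>, would be cheaper than \<open>q\<close> itself (lemma \<open>is_solution_head\<close>).  Therefore the whole
  trajectory of a minimizer lies in the existence set, and it joins the origin to the final
  condition; connectedness follows because all points are joined to the origin.  Admissible curves
  have to be cut and pasted for this, so most of the work is to see that absolute continuity,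
  integrability and the differential equation almost everywhere survive these operations.

  The existence set is not compact because it is unbounded: the straight segment is a minimizer
  towards \<open>(L, 0, 0)\<close> for every \<open>L \<ge> 0\<close>.  Indeed, a curve of length \<open>l\<close> costs at least \<open>\<xi> * l\<close>, and it
  moves by at most \<open>l\<close> in the first coordinate, as that coordinate has a derivative \<open>cos \<theta> \<le> 1\<close>
  almost everywhere.  A derivative bound almost everywhere controls the increment only thanks to
  absolute continuity (lemma \<open>absolutely_continuous_on_increment_le\<close>).
\<close>

section \<open>Absolutely continuous functions\<close>

definition disjoint_segments :: "real set \<Rightarrow> (real \<times> real) set \<Rightarrow> bool" where
  "disjoint_segments S D \<longleftrightarrow>
    finite D \<and> (\<forall>(a, b)\<in>D. a \<le> b \<and> {a..b} \<subseteq> S) \<and> disjoint_family_on (\<lambda>(a, b). {a<..<b}) D"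

lemma absolutely_continuous_on_iff:
  "absolutely_continuous_on S f \<longleftrightarrow>
    (\<forall>\<epsilon>>0. \<exists>\<delta>>0. \<forall>D. disjoint_segments S D \<and> (\<Sum>(a, b)\<in>D. b - a) < \<delta> \<longrightarrow>
      (\<Sum>(a, b)\<in>D. dist (f a) (f b)) < \<epsilon>)"
  unfolding absolutely_continuous_on_def disjoint_segments_def by (simp only: conj_assoc)

lemma absolutely_continuous_onE:
  assumes "absolutely_continuous_on S f" "\<epsilon> > 0"
  obtains \<delta> where "\<delta> > 0"
    "\<And>D. disjoint_segments S D \<Longrightarrow> (\<Sum>(a, b)\<in>D. b - a) < \<delta> \<Longrightarrow> (\<Sum>(a, b)\<in>D. dist (f a) (f b)) < \<epsilon>"
  using assms unfolding absolutely_continuous_on_iff by metis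

lemma disjoint_segments_subset:
  assumes "disjoint_segments S D" "E \<subseteq> D" "\<And>a b. (a, b) \<in> E \<Longrightarrow> {a..b} \<subseteq> T"
  shows "disjoint_segments T E"
proof -
  have D: "finite D" "\<And>a b. (a, b) \<in> D \<Longrightarrow> a \<le> b" "disjoint_family_on (\<lambda>(a, b). {a<..<b}) D"
    using assms(1) unfolding disjoint_segments_def by auto
  have "finite E"
    by (rule finite_subset[OF assms(2) D(1)])
  moreover have "\<forall>(a, b)\<in>E. a \<le> b \<and> {a..b} \<subseteq> T"
    using D(2) assms(2,3) by blast
  moreover have "disjoint_family_on (\<lambda>(a, b). {a<..<b}) E"
    using D(3) assms(2) by (rule disjoint_family_on_mono[rotated])
  ultimately show ?thesis
    unfolding disjoint_segments_def by blast
qed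

lemma absolutely_continuous_on_subset:
  assumes "absolutely_continuous_on S f" "T \<subseteq> S"
  shows "absolutely_continuous_on T f"
  unfolding absolutely_continuous_on_iff
proof (intro allI impI)
  fix \<epsilon> :: real assume "\<epsilon> > 0"
  then obtain \<delta> where \<delta>: "\<delta> > 0"
    "\<And>D. disjoint_segments S D \<Longrightarrow> (\<Sum>(a, b)\<in>D. b - a) < \<delta> \<Longrightarrow> (\<Sum>(a, b)\<in>D. dist (f a) (f b)) < \<epsilon>"
    using absolutely_continuous_onE[OF assms(1)] by metis
  have "disjoint_segments S D" if "disjoint_segments T D" for D
    using that assms(2) unfolding disjoint_segments_def by (fast intro: order_trans)
  then show "\<exists>\<delta>>0. \<forall>D. disjoint_segments T D \<and> (\<Sum>(a, b)\<in>D. b - a) < \<delta> \<longrightarrow>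
      (\<Sum>(a, b)\<in>D. dist (f a) (f b)) < \<epsilon>"
    using \<delta> by blast
qed

text \<open>
  This serves to pass to a component of a curve, and to exchange functions that agree on \<open>S\<close>.
\<close>

lemma absolutely_continuous_on_contraction:
  assumes f: "absolutely_continuous_on S f"
    and le: "\<And>x y. x \<in> S \<Longrightarrow> y \<in> S \<Longrightarrow> dist (g x) (g y) \<le> dist (f x) (f y)"
  shows "absolutely_continuous_on S g"
  unfolding absolutely_continuous_on_iff
proof (intro allI impI)
  fix \<epsilon> :: real assume "\<epsilon> > 0"
  then obtain \<delta> where \<delta>: "\<delta> > 0"
    "\<And>D. disjoint_segments S D \<Longrightarrow> (\<Sum>(a, b)\<in>D. b - a) < \<delta> \<Longrightarrow> (\<Sum>(a, b)\<in>D. dist (f a) (f b)) < \<epsilon>"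
    using absolutely_continuous_onE[OF f] by metis
  have "(\<Sum>(a, b)\<in>D. dist (g a) (g b)) \<le> (\<Sum>(a, b)\<in>D. dist (f a) (f b))"
    if D: "disjoint_segments S D" for D
  proof (rule sum_mono, clarify)
    fix a b assume "(a, b) \<in> D"
    then have "a \<in> S" "b \<in> S"
      using D unfolding disjoint_segments_def by fastforce+
    then show "dist (g a) (g b) \<le> dist (f a) (f b)"
      by (rule le)
  qed
  then show "\<exists>\<delta>>0. \<forall>D. disjoint_segments S D \<and> (\<Sum>(a, b)\<in>D. b - a) < \<delta> \<longrightarrow>
      (\<Sum>(a, b)\<in>D. dist (g a) (g b)) < \<epsilon>"
    using \<delta> by (meson le_less_trans)
qed

lemma absolutely_continuous_on_shift:
  assumes "absolutely_continuous_on {a..b} f"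
  shows "absolutely_continuous_on {a - c..b - c} (\<lambda>t. f (t + c))"
  unfolding absolutely_continuous_on_iff
proof (intro allI impI)
  fix \<epsilon> :: real assume "\<epsilon> > 0"
  then obtain \<delta> where \<delta>: "\<delta> > 0"
    "\<And>D. disjoint_segments {a..b} D \<Longrightarrow> (\<Sum>(u, w)\<in>D. w - u) < \<delta> \<Longrightarrow> (\<Sum>(u, w)\<in>D. dist (f u) (f w)) < \<epsilon>"
    using absolutely_continuous_onE[OF assms] by metis
  have "(\<Sum>(u, w)\<in>D. dist (f (u + c)) (f (w + c))) < \<epsilon>"
    if D: "disjoint_segments {a - c..b - c} D" and small: "(\<Sum>(u, w)\<in>D. w - u) < \<delta>" for D
  proof -
    define \<tau> where "\<tau> = (\<lambda>(u, w). (c + u, c + w))"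
    have inj: "inj_on \<tau> D"
      by (auto simp: inj_on_def \<tau>_def)
    have im: "disjoint_segments {a..b} (\<tau> ` D)"
      unfolding disjoint_segments_def
    proof (intro conjI)
      show "finite (\<tau> ` D)"
        using D by (simp add: disjoint_segments_def)
      show "\<forall>(u, w)\<in>\<tau> ` D. u \<le> w \<and> {u..w} \<subseteq> {a..b}"
        using D by (fastforce simp: disjoint_segments_def \<tau>_def)
      show "disjoint_family_on (\<lambda>(u, w). {u<..<w}) (\<tau> ` D)"
        unfolding disjoint_family_on_def
      proof (intro ballI impI)
        fix x y assume "x \<in> \<tau> ` D" "y \<in> \<tau> ` D" and "x \<noteq> y"
        then obtain u w u' w' where xy: "x = (c + u, c + w)" "y = (c + u', c + w')"
          and "(u, w) \<in> D" "(u', w') \<in> D" "(u, w) \<noteq> (u', w')"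
          by (auto simp: \<tau>_def)
        then have disj: "{u<..<w} \<inter> {u'<..<w'} = {}"
          using D unfolding disjoint_segments_def disjoint_family_on_def by fast
        show "(case x of (u, w) \<Rightarrow> {u<..<w}) \<inter> (case y of (u, w) \<Rightarrow> {u<..<w}) = {}"
        proof (rule equals0I)
          fix t assume "t \<in> (case x of (u, w) \<Rightarrow> {u<..<w}) \<inter> (case y of (u, w) \<Rightarrow> {u<..<w})"
          then have "t - c \<in> {u<..<w} \<inter> {u'<..<w'}"
            by (auto simp: xy)
          then show False
            unfolding disj by simp
        qed
      qed
    qed
    have "(\<Sum>(u, w)\<in>\<tau> ` D. w - u) = (\<Sum>(u, w)\<in>D. w - u)"
      unfolding sum.reindex[OF inj] by (rule sum.cong) (auto simp: \<tau>_def add.commute)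
    with \<delta>(2)[OF im] small have "(\<Sum>(u, w)\<in>\<tau> ` D. dist (f u) (f w)) < \<epsilon>"
      by simp
    moreover have "(\<Sum>(u, w)\<in>\<tau> ` D. dist (f u) (f w)) = (\<Sum>(u, w)\<in>D. dist (f (u + c)) (f (w + c)))"
      unfolding sum.reindex[OF inj] by (rule sum.cong) (auto simp: \<tau>_def add.commute)
    ultimately show ?thesis by simp
  qed
  then show "\<exists>\<delta>>0. \<forall>D. disjoint_segments {a - c..b - c} D \<and> (\<Sum>(u, w)\<in>D. w - u) < \<delta> \<longrightarrow>
      (\<Sum>(u, w)\<in>D. dist (f (u + c)) (f (w + c))) < \<epsilon>"
    using \<delta>(1) by blast
qed

lemma absolutely_continuous_on_uniform:
  assumes "absolutely_continuous_on {a..b} f" "\<epsilon> > 0"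
  obtains \<delta> where "\<delta> > 0"
    "\<And>u w. u \<in> {a..b} \<Longrightarrow> w \<in> {a..b} \<Longrightarrow> \<bar>w - u\<bar> < \<delta> \<Longrightarrow> dist (f u) (f w) < \<epsilon>"
proof -
  obtain \<delta> where \<delta>: "\<delta> > 0"
    "\<And>D. disjoint_segments {a..b} D \<Longrightarrow> (\<Sum>(u, w)\<in>D. w - u) < \<delta> \<Longrightarrow> (\<Sum>(u, w)\<in>D. dist (f u) (f w)) < \<epsilon>"
    using absolutely_continuous_onE[OF assms] by metis
  have ordered: "dist (f u) (f w) < \<epsilon>" if "u \<in> {a..b}" "w \<in> {a..b}" "u \<le> w" "w - u < \<delta>" for u w
    using \<delta>(2)[of "{(u, w)}"] that by (auto simp: disjoint_segments_def disjoint_family_on_def)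
  show thesis
  proof
    fix u w assume "u \<in> {a..b}" "w \<in> {a..b}" "\<bar>w - u\<bar> < \<delta>"
    then show "dist (f u) (f w) < \<epsilon>"
      using ordered[of u w] ordered[of w u] by (cases "u \<le> w") (auto simp: dist_commute)
  qed (rule \<delta>(1))
qed

lemma absolutely_continuous_on_imp_continuous_on:
  assumes "absolutely_continuous_on {a..b} f"
  shows "continuous_on {a..b} f"
  unfolding continuous_on_iff
proof (intro ballI allI impI)
  fix x \<epsilon> :: real assume x: "x \<in> {a..b}" and "\<epsilon> > 0"
  obtain \<delta> where "\<delta> > 0"
    "\<And>u w. u \<in> {a..b} \<Longrightarrow> w \<in> {a..b} \<Longrightarrow> \<bar>w - u\<bar> < \<delta> \<Longrightarrow> dist (f u) (f w) < \<epsilon>"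
    using absolutely_continuous_on_uniform[OF assms \<open>\<epsilon> > 0\<close>] by metis
  with x show "\<exists>d>0. \<forall>x'\<in>{a..b}. dist x' x < d \<longrightarrow> dist (f x') (f x) < \<epsilon>"
    by (metis dist_commute dist_real_def)
qed

text \<open>
  A family of disjoint segments splits into those left of \<open>c\<close>, those right of \<open>c\<close>, and at most one
  that straddles \<open>c\<close>.  Uniform continuity on both sides takes care of the last one, so that no
  segment needs to be cut.
\<close>

lemma absolutely_continuous_on_glue:
  assumes left: "absolutely_continuous_on {a..c} f" and right: "absolutely_continuous_on {c..b} f"
    and "a \<le> c" "c \<le> b"
  shows "absolutely_continuous_on {a..b} f"
  unfolding absolutely_continuous_on_iff
proof (intro allI impI)
  fix \<epsilon> :: real assume "\<epsilon> > 0"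
  then have e: "\<epsilon> / 4 > 0" by simp
  obtain \<delta>1 where d1: "\<delta>1 > 0"
    "\<And>D. disjoint_segments {a..c} D \<Longrightarrow> (\<Sum>(u, w)\<in>D. w - u) < \<delta>1 \<Longrightarrow> (\<Sum>(u, w)\<in>D. dist (f u) (f w)) < \<epsilon> / 4"
    using absolutely_continuous_onE[OF left e] by metis
  obtain \<delta>2 where d2: "\<delta>2 > 0"
    "\<And>D. disjoint_segments {c..b} D \<Longrightarrow> (\<Sum>(u, w)\<in>D. w - u) < \<delta>2 \<Longrightarrow> (\<Sum>(u, w)\<in>D. dist (f u) (f w)) < \<epsilon> / 4"
    using absolutely_continuous_onE[OF right e] by metis
  obtain \<delta>3 where d3: "\<delta>3 > 0"
    "\<And>u w. u \<in> {a..c} \<Longrightarrow> w \<in> {a..c} \<Longrightarrow> \<bar>w - u\<bar> < \<delta>3 \<Longrightarrow> dist (f u) (f w) < \<epsilon> / 4"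
    using absolutely_continuous_on_uniform[OF left e] by metis
  obtain \<delta>4 where d4: "\<delta>4 > 0"
    "\<And>u w. u \<in> {c..b} \<Longrightarrow> w \<in> {c..b} \<Longrightarrow> \<bar>w - u\<bar> < \<delta>4 \<Longrightarrow> dist (f u) (f w) < \<epsilon> / 4"
    using absolutely_continuous_on_uniform[OF right e] by metis
  \<comment> \<open>One quarter of \<open>\<epsilon>\<close> for each side, and one for each half of the straddling segment.\<close>
  define \<delta> where "\<delta> = min (min \<delta>1 \<delta>2) (min \<delta>3 \<delta>4)"
  have "(\<Sum>(u, w)\<in>D. dist (f u) (f w)) < \<epsilon>"
    if D: "disjoint_segments {a..b} D" and small: "(\<Sum>(u, w)\<in>D. w - u) < \<delta>" for D
  proof -
    have fin: "finite D" and seg: "\<And>u w. (u, w) \<in> D \<Longrightarrow> u \<le> w \<and> a \<le> u \<and> w \<le> b"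
      using D unfolding disjoint_segments_def by fastforce+
    define A where "A = {(u, w) \<in> D. w \<le> c}"
    define B where "B = {(u, w) \<in> D. c < w \<and> c \<le> u}"
    define C where "C = {(u, w) \<in> D. u < c \<and> c < w}"
    have sub: "A \<subseteq> D" "B \<subseteq> D" "C \<subseteq> D" and D_eq: "D = A \<union> (B \<union> C)"
      and disj: "A \<inter> (B \<union> C) = {}" "B \<inter> C = {}"
      by (auto simp: A_def B_def C_def)
    note fins = sub[THEN finite_subset[OF _ fin]]
    have part: "(\<Sum>(u, w)\<in>E. w - u) < \<delta>" if "E \<subseteq> D" for E
      using sum_mono2[OF fin that, of "\<lambda>(u, w). w - u"] seg small by force
    have sA: "(\<Sum>(u, w)\<in>A. dist (f u) (f w)) < \<epsilon> / 4"
    proof (rule d1(2))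
      show "disjoint_segments {a..c} A"
        by (rule disjoint_segments_subset[OF D sub(1)]) (auto simp: A_def dest: seg)
    qed (use part[OF sub(1)] in \<open>simp add: \<delta>_def\<close>)
    have sB: "(\<Sum>(u, w)\<in>B. dist (f u) (f w)) < \<epsilon> / 4"
    proof (rule d2(2))
      show "disjoint_segments {c..b} B"
        by (rule disjoint_segments_subset[OF D sub(2)]) (auto simp: B_def dest: seg)
    qed (use part[OF sub(2)] in \<open>simp add: \<delta>_def\<close>)
    \<comment> \<open>The open segments are disjoint, so at most one of them contains \<open>c\<close>.\<close>
    have "p = p'" if "p \<in> C" "p' \<in> C" for p p'
    proof (rule ccontr)
      assume "p \<noteq> p'"
      moreover have "p \<in> D" "p' \<in> D" using that sub by auto
      ultimately have "(case p of (u, w) \<Rightarrow> {u<..<w}) \<inter> (case p' of (u, w) \<Rightarrow> {u<..<w}) = {}"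
        using D unfolding disjoint_segments_def disjoint_family_on_def by blast
      moreover have "c \<in> (case p of (u, w) \<Rightarrow> {u<..<w}) \<inter> (case p' of (u, w) \<Rightarrow> {u<..<w})"
        using that by (auto simp: C_def)
      ultimately show False by blast
    qed
    then consider "C = {}" | u w where "C = {(u, w)}"
      by (metis is_singletonI' is_singleton_def surj_pair)
    then have sC: "(\<Sum>(u, w)\<in>C. dist (f u) (f w)) < \<epsilon> / 2"
    proof cases
      case 1
      then show ?thesis using \<open>\<epsilon> > 0\<close> by simp
    next
      case (2 u w)
      then have "(u, w) \<in> C" "(u, w) \<in> D"
        using sub(3) by auto
      then have uw: "u < c" "c < w" "a \<le> u" "w \<le> b"
        using seg by (auto simp: C_def)
      have "w - u < \<delta>"
        using part[OF sub(3)] 2 by simp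
      then have "dist (f u) (f c) < \<epsilon> / 4" "dist (f c) (f w) < \<epsilon> / 4"
        using uw d3(2)[of u c] d4(2)[of c w] by (auto simp: \<delta>_def)
      then show ?thesis
        using 2 dist_triangle[of "f u" "f w" "f c"] by simp
    qed
    show ?thesis
      unfolding D_eq using sA sB sC fins disj by (simp add: sum.union_disjoint)
  qed
  moreover have "\<delta> > 0"
    using d1 d2 d3 d4 by (simp add: \<delta>_def)
  ultimately show "\<exists>\<delta>>0. \<forall>D. disjoint_segments {a..b} D \<and> (\<Sum>(u, w)\<in>D. w - u) < \<delta> \<longrightarrow>
      (\<Sum>(u, w)\<in>D. dist (f u) (f w)) < \<epsilon>"
    by blast
qed

text \<open>
  The exceptional null set \<open>N\<close> is covered by an open set \<open>U\<close> of measure below the \<open>\<delta>\<close> of absolute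
  continuity.  By Cousin's lemma there is a tagged division of \<open>{a..b}\<close> so fine that the segments with
  a tag in \<open>N\<close> lie in \<open>U\<close>, and that on the other segments the difference quotient exceeds the
  derivative at the tag by at most \<open>\<epsilon>\<close>.  The segments of the first kind contribute at most \<open>\<epsilon>\<close> to the
  increment of \<open>f\<close>, and those of the second kind at most \<open>(K + \<epsilon>) * (b - a)\<close>.
\<close>

lemma absolutely_continuous_on_increment_le:
  fixes f :: "real \<Rightarrow> real"
  assumes "a \<le> b" "0 \<le> K" and ac: "absolutely_continuous_on {a..b} f"
    and deriv: "AE s in lebesgue. s \<in> {a..b} \<longrightarrow>
      (\<exists>D\<le>K. (f has_real_derivative D) (at s within {a..b}))"
  shows "f b - f a \<le> K * (b - a)"
proof -
  have approx: "f b - f a \<le> (K + \<epsilon>) * (b - a) + \<epsilon>" if "\<epsilon> > 0" for \<epsilon>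
  proof -
    obtain \<delta> where \<delta>: "\<delta> > 0"
      "\<And>D. disjoint_segments {a..b} D \<Longrightarrow> (\<Sum>(u, w)\<in>D. w - u) < \<delta> \<Longrightarrow> (\<Sum>(u, w)\<in>D. dist (f u) (f w)) < \<epsilon>"
      using absolutely_continuous_onE[OF ac \<open>\<epsilon> > 0\<close>] by metis
    define N where "N = {s \<in> {a..b}. \<not> (\<exists>D\<le>K. (f has_real_derivative D) (at s within {a..b}))}"
    have "negligible N"
      using deriv unfolding eventually_ae_filter_negligible N_def
      by (auto intro: negligible_subset)
    then have N0: "N \<in> sets lebesgue" "measure lebesgue N = 0" "N \<in> lmeasurable"
      by (auto simp: negligible_iff_null_sets negligible_imp_measurable negligible_imp_measure0)
    obtain U where U: "open U" "N \<subseteq> U" "U \<in> lmeasurable" "measure lebesgue U < \<delta>"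
    proof -
      obtain U where U: "open U" "N \<subseteq> U" "U - N \<in> lmeasurable" "emeasure lebesgue (U - N) < ennreal \<delta>"
        using sets_lebesgue_outer_open[OF N0(1) \<delta>(1)] by metis
      have U_eq: "U = (U - N) \<union> N"
        using U(2) by blast
      have "U \<in> lmeasurable"
        by (subst U_eq) (intro fmeasurable.Un U(3) N0(3))
      moreover have "measure lebesgue U \<le> measure lebesgue (U - N) + measure lebesgue N"
        by (subst U_eq) (intro measure_Un_le fmeasurableD U(3) N0(1))
      moreover have "measure lebesgue (U - N) < \<delta>"
        using U(3,4) \<delta>(1) by (simp add: emeasure_eq_measure2 ennreal_less_iff)
      ultimately show thesis
        using that U N0(2) by auto
    qed
    \<comment> \<open>The radius of a suitable gauge at each point.\<close>
    have "\<exists>d>0. (s \<in> N \<longrightarrow> ball s d \<subseteq> U) \<and>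
      (s \<in> {a..b} - N \<longrightarrow> (\<forall>u\<in>{a..b}. \<forall>w\<in>{a..b}. u \<le> s \<longrightarrow> s \<le> w \<longrightarrow> dist s u < d \<longrightarrow> dist s w < d \<longrightarrow>
        f w - f u \<le> (K + \<epsilon>) * (w - u)))" for s
    proof -
      consider "s \<in> N" | "s \<in> {a..b} - N" | "s \<notin> {a..b}" "s \<notin> N" by blast
      then show ?thesis
      proof cases
        case 1
        then show ?thesis
          using U(1,2) unfolding open_contains_ball by blast
      next
        case 2
        then obtain D where "D \<le> K" and D: "(f has_real_derivative D) (at s within {a..b})"
          by (auto simp: N_def)
        then obtain d where "d > 0" and d: "\<And>y. y \<in> {a..b} \<Longrightarrow> norm (y - s) < d \<Longrightarrow>
            norm (f y - f s - D * (y - s)) \<le> \<epsilon> * norm (y - s)"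
          using \<open>\<epsilon> > 0\<close> unfolding has_field_derivative_def has_derivative_within_alt by metis
        have "f w - f u \<le> (K + \<epsilon>) * (w - u)"
          if "u \<in> {a..b}" "w \<in> {a..b}" "u \<le> s" "s \<le> w" "dist s u < d" "dist s w < d" for u w
        proof -
          have "\<bar>f w - f s - D * (w - s)\<bar> \<le> \<epsilon> * \<bar>w - s\<bar>" "\<bar>f u - f s - D * (u - s)\<bar> \<le> \<epsilon> * \<bar>u - s\<bar>"
            using d[of w] d[of u] that by (auto simp: dist_real_def abs_minus_commute)
          moreover have "\<bar>w - s\<bar> = w - s" "\<bar>u - s\<bar> = s - u"
            using that by auto
          ultimately have "f w - f u \<le> (D + \<epsilon>) * (w - u)"
            by (simp add: algebra_simps abs_le_iff)
          also have "\<dots> \<le> (K + \<epsilon>) * (w - u)"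
            using \<open>D \<le> K\<close> that by (intro mult_right_mono) auto
          finally show ?thesis .
        qed
        with 2 \<open>d > 0\<close> show ?thesis by blast
      next
        case 3
        then show ?thesis by (intro exI[of _ 1]) auto
      qed
    qed
    then obtain d where d_pos: "\<And>s. d s > 0" and d_N: "\<And>s. s \<in> N \<Longrightarrow> ball s (d s) \<subseteq> U"
      and d_good: "\<And>s u w. s \<in> {a..b} - N \<Longrightarrow> u \<in> {a..b} \<Longrightarrow> w \<in> {a..b} \<Longrightarrow> u \<le> s \<Longrightarrow> s \<le> w \<Longrightarrow>
        dist s u < d s \<Longrightarrow> dist s w < d s \<Longrightarrow> f w - f u \<le> (K + \<epsilon>) * (w - u)"
      by metis
    obtain p where p: "p tagged_division_of {a..b}" and fine: "(\<lambda>s. ball s (d s)) fine p"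
      using fine_division_exists_real[OF gauge_ball_dependent, of d] d_pos by blast
    note fin = tagged_division_of_finite[OF p]
    have tag: "\<exists>u w. k = {u..w} \<and> u \<le> s \<and> s \<le> w \<and> a \<le> u \<and> w \<le> b \<and> k \<subseteq> ball s (d s)"
      if sk: "(s, k) \<in> p" for s k
    proof -
      obtain u w where uw: "k = {u..w}"
        using tagged_division_ofD(4)[OF p sk] by auto
      have "s \<in> k" "k \<subseteq> {a..b}"
        using tagged_division_ofD(2,3)[OF p sk] by auto
      then show ?thesis
        using fineD[OF fine sk] uw by auto
    qed
    define q where "q = {(s, k) \<in> p. s \<in> N}"
    have "q \<subseteq> p"
      by (auto simp: q_def)
    have "p tagged_partial_division_of {a..b}"
      using p unfolding tagged_division_of_def by (rule conjunct1)
    then have q_tagged: "q tagged_division_of \<Union>(snd ` q)"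
      using tagged_partial_division_of_Union_self tagged_partial_division_subset \<open>q \<subseteq> p\<close> by metis
    note q_div = division_of_tagged_division[OF q_tagged]
    have bad: "(\<Sum>(s, k)\<in>q. f (Sup k) - f (Inf k)) \<le> \<epsilon>"
    proof -
      define ends where "ends k = (Inf k, Sup k)" for k :: "real set"
      have piece: "\<exists>u w. k = {u..w} \<and> u \<le> w \<and> a \<le> u \<and> w \<le> b \<and> k \<subseteq> U" if k: "k \<in> snd ` q" for k
      proof -
        obtain s where "(s, k) \<in> p" "s \<in> N"
          using k by (auto simp: q_def)
        with tag[of s k] d_N[of s] show ?thesis
          by fastforce
      qed
      have inj: "inj_on ends (snd ` q)"
      proof (rule inj_onI)
        fix k k' assume "k \<in> snd ` q" "k' \<in> snd ` q" and eq: "ends k = ends k'"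
        then obtain u w u' w' where "k = {u..w}" "u \<le> w" "k' = {u'..w'}" "u' \<le> w'"
          using piece by metis
        with eq show "k = k'"
          by (simp add: ends_def)
      qed
      have segments: "disjoint_segments {a..b} (ends ` snd ` q)"
        unfolding disjoint_segments_def
      proof (intro conjI)
        show "finite (ends ` snd ` q)"
          by (intro finite_imageI finite_subset[OF \<open>q \<subseteq> p\<close> fin])
        show "\<forall>(u, w)\<in>ends ` snd ` q. u \<le> w \<and> {u..w} \<subseteq> {a..b}"
        proof (rule ballI)
          fix x assume "x \<in> ends ` snd ` q"
          then obtain u w where "x = ends {u..w}" "u \<le> w" "a \<le> u" "w \<le> b"
            using piece by (metis imageE)
          then show "case x of (u, w) \<Rightarrow> u \<le> w \<and> {u..w} \<subseteq> {a..b}"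
            by (simp add: ends_def)
        qed
        show "disjoint_family_on (\<lambda>(u, w). {u<..<w}) (ends ` snd ` q)"
          unfolding disjoint_family_on_def
        proof (intro ballI impI)
          fix x y assume "x \<in> ends ` snd ` q" "y \<in> ends ` snd ` q" and "x \<noteq> y"
          then obtain k k' where k: "k \<in> snd ` q" "k' \<in> snd ` q" "x = ends k" "y = ends k'"
            by (elim imageE[of _ ends])
          with \<open>x \<noteq> y\<close> have ne: "k \<noteq> k'"
            by auto
          obtain u w u' w' where "k = {u..w}" "u \<le> w" "k' = {u'..w'}" "u' \<le> w'"
            using piece k(1,2) by metis
          with division_ofD(5)[OF q_div k(1,2) ne] k(3,4)
          show "(case x of (u, w) \<Rightarrow> {u<..<w}) \<inter> (case y of (u, w) \<Rightarrow> {u<..<w}) = {}"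
            by (simp add: ends_def)
        qed
      qed
      have "(\<Sum>(u, w)\<in>ends ` snd ` q. w - u) = (\<Sum>k\<in>snd ` q. measure lebesgue k)"
        unfolding sum.reindex[OF inj]
      proof (rule sum.cong)
        fix k assume "k \<in> snd ` q"
        then obtain u w where "k = {u..w}" "u \<le> w"
          using piece by metis
        then show "((\<lambda>(u, w). w - u) \<circ> ends) k = measure lebesgue k"
          by (simp add: ends_def)
      qed simp
      also have "\<dots> = measure lebesgue (\<Union>(snd ` q))"
        by (rule content_division[OF q_div])
      also have "\<dots> \<le> measure lebesgue U"
      proof (rule measure_mono_fmeasurable)
        show "\<Union>(snd ` q) \<subseteq> U"
          using piece by (metis Sup_least)
      qed (intro U(3) fmeasurableD lmeasurable_division[OF q_div])+
      finally have small: "(\<Sum>(u, w)\<in>ends ` snd ` q. w - u) < \<delta>"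
        using U(4) by simp
      \<comment> \<open>\<open>Inf\<close> and \<open>Sup\<close> of the empty set are unspecified reals, and the passage from tagged
          segments to segments below asks for a summand that vanishes there.\<close>
      define g where "g k = (if k = {} then 0 else dist (f (Inf k)) (f (Sup k)))" for k
      have "(\<Sum>(s, k)\<in>q. f (Sup k) - f (Inf k)) \<le> (\<Sum>(s, k)\<in>q. g k)"
      proof (rule sum_mono, clarify)
        fix s k assume "(s, k) \<in> q"
        then have "k \<noteq> {}"
          using piece[of k] by force
        then show "f (Sup k) - f (Inf k) \<le> g k"
          by (simp add: g_def dist_real_def)
      qed
      also have "\<dots> = (\<Sum>k\<in>snd ` q. g k)"
        by (rule sum.over_tagged_division_lemma[OF q_tagged]) (auto simp: g_def)
      also have "\<dots> = (\<Sum>(u, w)\<in>ends ` snd ` q. dist (f u) (f w))"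
        unfolding sum.reindex[OF inj]
      proof (rule sum.cong)
        fix k assume "k \<in> snd ` q"
        then have "k \<noteq> {}"
          using piece[of k] by force
        then show "g k = ((\<lambda>(u, w). dist (f u) (f w)) \<circ> ends) k"
          by (simp add: g_def ends_def)
      qed simp
      also have "\<dots> < \<epsilon>"
        by (rule \<delta>(2)[OF segments small])
      finally show ?thesis by simp
    qed
    have good: "(\<Sum>(s, k)\<in>p - q. f (Sup k) - f (Inf k)) \<le> (K + \<epsilon>) * (b - a)"
    proof -
      have "(\<Sum>(s, k)\<in>p - q. f (Sup k) - f (Inf k)) \<le> (\<Sum>(s, k)\<in>p - q. (K + \<epsilon>) * measure lborel k)"
      proof (rule sum_mono, clarify)
        fix s k assume sk: "(s, k) \<in> p" "(s, k) \<notin> q"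
        then have "s \<notin> N"
          by (simp add: q_def)
        obtain u w where k: "k = {u..w}" "u \<le> s" "s \<le> w" "a \<le> u" "w \<le> b" "k \<subseteq> ball s (d s)"
          using tag[OF sk(1)] by metis
        then have "u \<in> k" "w \<in> k"
          by simp_all
        then have "dist s u < d s" "dist s w < d s"
          using k(6) by (metis mem_ball subsetD)+
        then have "f w - f u \<le> (K + \<epsilon>) * (w - u)"
          using k(2-5) \<open>s \<notin> N\<close> \<open>dist s u < d s\<close> \<open>dist s w < d s\<close> by (intro d_good[of s]) simp_all
        with k(1-3) show "f (Sup k) - f (Inf k) \<le> (K + \<epsilon>) * measure lborel k"
          by simp
      qed
      also have "\<dots> \<le> (\<Sum>(s, k)\<in>p. (K + \<epsilon>) * measure lborel k)"
        using \<open>0 \<le> K\<close> \<open>\<epsilon> > 0\<close> by (intro sum_mono2 fin) auto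
      also have "\<dots> = (K + \<epsilon>) * (b - a)"
        using additive_content_tagged_division[of p a b] p \<open>a \<le> b\<close>
        by (simp add: sum_distrib_left[symmetric] split_def)
      finally show ?thesis .
    qed
    have "f b - f a = (\<Sum>(s, k)\<in>p. f (Sup k) - f (Inf k))"
      using additive_tagged_division_1[OF \<open>a \<le> b\<close> p, of f] by simp
    also have "\<dots> = (\<Sum>(s, k)\<in>p - q. f (Sup k) - f (Inf k)) + (\<Sum>(s, k)\<in>q. f (Sup k) - f (Inf k))"
      by (rule sum.subset_diff[OF \<open>q \<subseteq> p\<close> fin])
    finally show ?thesis
      using good bad by linarith
  qed
  show ?thesis
  proof (rule field_le_epsilon)
    fix e :: real assume "e > 0"
    define \<epsilon> where "\<epsilon> = e / (b - a + 1)"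
    have "\<epsilon> > 0" "\<epsilon> * (b - a + 1) = e"
      using \<open>e > 0\<close> \<open>a \<le> b\<close> by (simp_all add: \<epsilon>_def)
    have "f b - f a \<le> (K + \<epsilon>) * (b - a) + \<epsilon>"
      by (rule approx[OF \<open>\<epsilon> > 0\<close>])
    also have "\<dots> = K * (b - a) + \<epsilon> * (b - a + 1)"
      by (simp add: algebra_simps)
    also note \<open>\<epsilon> * (b - a + 1) = e\<close>
    finally show "f b - f a \<le> K * (b - a) + e" .
  qed
qed


section \<open>The differential equation at a single time\<close>

text \<open>
  The control enters only through its value \<open>w\<close> at the time \<open>s\<close>.  Up to the two endpoints, which form
  a null set, the equation on an interval is the one on the whole line
  (\<open>follows_control_interior\<close>), and the latter depends only on the germ of \<open>q\<close> at \<open>s\<close>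
  (\<open>follows_control_cong\<close>); this is what makes it stable under cutting and pasting.
\<close>

definition follows_control :: "(real \<Rightarrow> config) \<Rightarrow> real \<Rightarrow> real \<Rightarrow> real set \<Rightarrow> bool" where
  "follows_control q w s S \<longleftrightarrow>
    ((\<lambda>t. fst (q t)) has_real_derivative circle_cos (snd (snd (q s)))) (at s within S) \<and>
    ((\<lambda>t. fst (snd (q t))) has_real_derivative circle_sin (snd (snd (q s)))) (at s within S) \<and>
    has_angular_derivative (\<lambda>t. snd (snd (q t))) w s S"

lemma admissible_iff:
  "admissible q_in q_fin l q v \<longleftrightarrow>
    0 \<le> l \<and> set_integrable lebesgue {0..l} v \<and> absolutely_continuous_on {0..l} q \<and>
    (AE s in lebesgue. s \<in> {0..l} \<longrightarrow> follows_control q (v s) s {0..l}) \<and> q 0 = q_in \<and> q l = q_fin"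
  unfolding admissible_def follows_control_def by (rule refl)

lemma follows_control_interior:
  assumes "a < s" "s < b"
  shows "follows_control q w s {a..b} \<longleftrightarrow> follows_control q w s UNIV"
  using at_within_Icc_at[OF assms] by (simp add: follows_control_def has_angular_derivative_def)

lemma follows_control_cong:
  assumes "open T" "s \<in> T" "\<And>t. t \<in> T \<Longrightarrow> q t = q' t"
  shows "follows_control q w s UNIV \<longleftrightarrow> follows_control q' w s UNIV"
proof -
  have dir: "follows_control q' w s UNIV"
    if q: "follows_control q w s UNIV" and eq: "\<And>t. t \<in> T \<Longrightarrow> q t = q' t" for q q'
  proof -
    have ev: "\<forall>\<^sub>F t in at s. q t = q' t"
      using eventually_at_topological assms(1,2) eq by blast
    have "((\<lambda>t. fst (q' t)) has_real_derivative circle_cos (snd (snd (q' s)))) (at s)"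
      "((\<lambda>t. fst (snd (q' t))) has_real_derivative circle_sin (snd (snd (q' s)))) (at s)"
      using q assms eq[of s] unfolding follows_control_def
      by (auto elim!: has_field_derivative_transform_within_open[OF _ assms(1,2)] simp: eq)
    moreover have "has_angular_derivative (\<lambda>t. snd (snd (q' t))) w s UNIV"
    proof -
      obtain \<phi> where \<phi>: "snd (snd (q s)) = angle (\<phi> s)" "\<forall>\<^sub>F t in at s. snd (snd (q t)) = angle (\<phi> t)"
        "(\<phi> has_real_derivative w) (at s)"
        using q unfolding follows_control_def has_angular_derivative_def by auto
      have "\<forall>\<^sub>F t in at s. snd (snd (q' t)) = angle (\<phi> t)"
        using ev \<phi>(2) by eventually_elim simp
      with \<phi> eq[OF assms(2)] show ?thesis
        unfolding has_angular_derivative_def by auto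
    qed
    ultimately show ?thesis
      unfolding follows_control_def by simp
  qed
  show ?thesis
    using dir[of q q'] dir[of q' q] assms(3) by (auto simp: eq_commute)
qed

lemma follows_control_shift:
  assumes "follows_control q w (s + c) UNIV"
  shows "follows_control (\<lambda>t. q (t + c)) w s UNIV"
proof -
  obtain \<phi> where \<phi>: "snd (snd (q (s + c))) = angle (\<phi> (s + c))"
    "\<forall>\<^sub>F t in at (s + c). snd (snd (q t)) = angle (\<phi> t)" "(\<phi> has_real_derivative w) (at (s + c))"
    using assms unfolding follows_control_def has_angular_derivative_def by auto
  have "\<forall>\<^sub>F t in at s. snd (snd (q (t + c))) = angle (\<phi> (t + c))"
    using \<phi>(2) unfolding at_to_0[of s] at_to_0[of "s + c"] eventually_filtermap by (simp add: add_ac)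
  then have "has_angular_derivative (\<lambda>t. snd (snd (q (t + c)))) w s UNIV"
    unfolding has_angular_derivative_def using \<phi>(1,3) by (intro exI[of _ "\<lambda>t. \<phi> (t + c)"]) (simp add: DERIV_shift)
  with assms show ?thesis
    unfolding follows_control_def by (simp add: DERIV_shift)
qed

section \<open>Translation and splitting of integrals\<close>

lemma AE_lebesgue_shift:
  fixes c :: real
  assumes "AE s in lebesgue. P s"
  shows "AE s in lebesgue. P (s + c)"
proof -
  obtain N where N: "negligible N" "{s. \<not> P s} \<subseteq> N"
    using assms unfolding eventually_ae_filter_negligible by blast
  have "{s. \<not> P (s + c)} \<subseteq> (+) (- c) ` N"
    using N(2) by (force intro: image_eqI[of _ _ "_ + c"])
  with negligible_translation[OF N(1)] show ?thesis
    unfolding eventually_ae_filter_negligible by blast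
qed

lemma AE_lebesgue_neq: "AE s in lebesgue. s \<noteq> (c :: real)"
  unfolding eventually_ae_filter_negligible by (intro exI[of _ "{c}"]) auto

lemma set_lebesgue_shift:
  fixes f :: "real \<Rightarrow> real"
  assumes "set_integrable lebesgue {a..b} f"
  shows "set_integrable lebesgue {a - c..b - c} (\<lambda>t. f (t + c))"
    and "(LINT t:{a - c..b - c}|lebesgue. f (t + c)) = (LINT t:{a..b}|lebesgue. f t)"
proof -
  have im: "(\<lambda>t. t + c) ` {a - c..b - c} = {a..b}"
    by simp
  have "(\<lambda>t. \<bar>1\<bar> * f (t + c)) absolutely_integrable_on {a - c..b - c} \<and>
      integral {a - c..b - c} (\<lambda>t. \<bar>1\<bar> * f (t + c)) = integral {a..b} f \<longleftrightarrow>
      f absolutely_integrable_on (\<lambda>t. t + c) ` {a - c..b - c} \<and>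
      integral ((\<lambda>t. t + c) ` {a - c..b - c}) f = integral {a..b} f"
    by (rule has_absolute_integral_change_of_variables_1')
      (auto intro!: derivative_eq_intros simp: inj_on_def)
  then have shifted: "set_integrable lebesgue {a - c..b - c} (\<lambda>t. f (t + c))"
      "integral {a - c..b - c} (\<lambda>t. f (t + c)) = integral {a..b} f"
    using assms unfolding im by auto
  then show "set_integrable lebesgue {a - c..b - c} (\<lambda>t. f (t + c))"
    "(LINT t:{a - c..b - c}|lebesgue. f (t + c)) = (LINT t:{a..b}|lebesgue. f t)"
    using assms by (simp_all add: set_lebesgue_integral_eq_integral)
qed

lemma set_integral_Icc_split:
  fixes f :: "real \<Rightarrow> real"
  assumes "set_integrable lebesgue {a..c} f" "set_integrable lebesgue {c..b} f" "a \<le> c" "c \<le> b"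
  shows "(LINT t:{a..b}|lebesgue. f t) = (LINT t:{a..c}|lebesgue. f t) + (LINT t:{c..b}|lebesgue. f t)"
proof -
  have "{a..b} = {a..c} \<union> {c..b}"
    using assms(3,4) by auto
  then show ?thesis
    using AE_lebesgue_neq[of c] assms by (auto intro!: set_integral_Un_AE elim: eventually_mono)
qed

text \<open>
  The cost of an admissible curve is finite since its density is at most \<open>\<bar>\<xi>\<bar> + \<bar>v s\<bar>\<close>.  This matters
  because the integral of a function that is not integrable is \<open>0\<close>.
\<close>

lemma set_integrable_cost_density:
  fixes v :: "real \<Rightarrow> real"
  assumes "set_integrable lebesgue {a..b} v"
  shows "set_integrable lebesgue {a..b} (\<lambda>s. sqrt (\<xi>\<^sup>2 + (v s)\<^sup>2))"
proof (rule set_integrable_bound)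
  show "set_integrable lebesgue {a..b} (\<lambda>s. \<bar>\<xi>\<bar> + \<bar>v s\<bar>)"
    using assms lmeasurable_cbox[of a b]
    by (intro set_integral_add set_integrable_abs absolutely_integrable_on_const) auto
  \<comment> \<open>Only the product of \<open>v\<close> with the indicator function is known to be measurable.\<close>
  have v: "(\<lambda>s. indicator {a..b} s * v s) \<in> borel_measurable lebesgue"
    using assms by (auto simp: set_integrable_def)
  have "(\<lambda>s. indicator {a..b} s * sqrt (\<xi>\<^sup>2 + (indicator {a..b} s * v s)\<^sup>2)) \<in> borel_measurable lebesgue"
    by (intro borel_measurable_times borel_measurable_indicator borel_measurable_add
        borel_measurable_power v borel_measurable_const measurable_compose[OF _ borel_measurable_sqrt]) auto
  also have "(\<lambda>s. indicator {a..b} s * sqrt (\<xi>\<^sup>2 + (indicator {a..b} s * v s)\<^sup>2)) =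
      (\<lambda>s. indicator {a..b} s * sqrt (\<xi>\<^sup>2 + (v s)\<^sup>2))"
    by (auto simp: indicator_def)
  finally show "set_borel_measurable lebesgue {a..b} (\<lambda>s. sqrt (\<xi>\<^sup>2 + (v s)\<^sup>2))"
    by (simp add: set_borel_measurable_def)
  show "AE s in lebesgue. s \<in> {a..b} \<longrightarrow> norm (sqrt (\<xi>\<^sup>2 + (v s)\<^sup>2)) \<le> norm (\<bar>\<xi>\<bar> + \<bar>v s\<bar>)"
    using sqrt_sum_squares_le_sum_abs[of \<xi>] by simp
qed

section \<open>Cutting and pasting admissible curves\<close>

lemma admissible_head:
  assumes "admissible q_in q_fin l q v" "s \<in> {0..l}"
  shows "admissible q_in (q s) s q v"
proof -
  have sub: "{0..s} \<subseteq> {0..l}" using assms(2) by auto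
  have ae: "AE t in lebesgue. t \<in> {0..l} \<longrightarrow> follows_control q (v t) t {0..l}"
    using assms(1) unfolding admissible_iff by auto
  have "AE t in lebesgue. t \<in> {0..s} \<longrightarrow> follows_control q (v t) t {0..s}"
    using AE_lebesgue_neq[of 0] AE_lebesgue_neq[of s] ae
  proof eventually_elim
    case (elim t)
    then show ?case
      using assms(2) follows_control_interior[of 0 t s] follows_control_interior[of 0 t l] by auto
  qed
  with assms sub show ?thesis
    unfolding admissible_iff
    by (auto intro: set_integrable_subset absolutely_continuous_on_subset)
qed

lemma admissible_tail:
  assumes "admissible q_in q_fin l q v" "s \<in> {0..l}"
  shows "admissible (q s) q_fin (l - s) (\<lambda>t. q (t + s)) (\<lambda>t. v (t + s))"
proof -
  have q: "set_integrable lebesgue {0..l} v" "absolutely_continuous_on {0..l} q"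
    "AE t in lebesgue. t \<in> {0..l} \<longrightarrow> follows_control q (v t) t {0..l}" "q l = q_fin"
    using assms(1) unfolding admissible_iff by auto
  have sub: "{s..l} \<subseteq> {0..l}" using assms(2) by auto
  have "AE t in lebesgue. t \<in> {0..l - s} \<longrightarrow>
      follows_control (\<lambda>t. q (t + s)) (v (t + s)) t {0..l - s}"
    using AE_lebesgue_neq[of 0] AE_lebesgue_neq[of "l - s"] AE_lebesgue_shift[OF q(3), of s]
  proof eventually_elim
    case (elim t)
    then show ?case
      using assms(2) follows_control_interior[of 0 t "l - s"] follows_control_interior[of 0 "t + s" l]
      by (auto intro: follows_control_shift)
  qed
  moreover have "set_integrable lebesgue {0..l - s} (\<lambda>t. v (t + s))"
    using set_lebesgue_shift(1)[of s l v s] set_integrable_subset[OF q(1) _ sub] by simp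
  moreover have "absolutely_continuous_on {0..l - s} (\<lambda>t. q (t + s))"
    using absolutely_continuous_on_shift[of s l q s] absolutely_continuous_on_subset[OF q(2) sub] by simp
  ultimately show ?thesis
    unfolding admissible_iff using assms(2) q(4) by auto
qed

lemma cost_split:
  assumes "set_integrable lebesgue {0..l} v" "s \<in> {0..l}"
  shows "cost \<xi> l v = cost \<xi> s v + cost \<xi> (l - s) (\<lambda>t. v (t + s))"
proof -
  have sub: "{0..s} \<subseteq> {0..l}" "{s..l} \<subseteq> {0..l}"
    using assms(2) by auto
  note int = sub[THEN set_integrable_subset[OF set_integrable_cost_density[OF assms(1), of \<xi>], rotated]]
  have "cost \<xi> l v = cost \<xi> s v + (LINT t:{s..l}|lebesgue. sqrt (\<xi>\<^sup>2 + (v t)\<^sup>2))"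
    unfolding cost_def using assms(2) int by (intro set_integral_Icc_split) auto
  also have "(LINT t:{s..l}|lebesgue. sqrt (\<xi>\<^sup>2 + (v t)\<^sup>2)) = cost \<xi> (l - s) (\<lambda>t. v (t + s))"
    using set_lebesgue_shift(2)[OF int(2), of s] by (simp add: cost_def)
  finally show ?thesis .
qed

text \<open>
  At the junction \<open>m\<close> the first function decides.  For curves that meet there the choice is
  immaterial, and for controls it concerns a null set.
\<close>

definition join_at :: "real \<Rightarrow> (real \<Rightarrow> 'a) \<Rightarrow> (real \<Rightarrow> 'a) \<Rightarrow> real \<Rightarrow> 'a" where
  "join_at m f g t = (if t \<le> m then f t else g (t - m))"

lemma admissible_concat:
  assumes "admissible q_in p m q1 v1" "admissible p q_fin n q2 v2"
  shows "admissible q_in q_fin (m + n) (join_at m q1 q2) (join_at m v1 v2)"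
    and "cost \<xi> (m + n) (join_at m v1 v2) = cost \<xi> m v1 + cost \<xi> n v2"
proof -
  define q v where "q = join_at m q1 q2" and "v = join_at m v1 v2"
  have 1: "0 \<le> m" "set_integrable lebesgue {0..m} v1" "absolutely_continuous_on {0..m} q1"
    "AE t in lebesgue. t \<in> {0..m} \<longrightarrow> follows_control q1 (v1 t) t {0..m}" "q1 0 = q_in" "q1 m = p"
    using assms(1) unfolding admissible_iff by auto
  have 2: "0 \<le> n" "set_integrable lebesgue {0..n} v2" "absolutely_continuous_on {0..n} q2"
    "AE t in lebesgue. t \<in> {0..n} \<longrightarrow> follows_control q2 (v2 t) t {0..n}" "q2 0 = p" "q2 n = q_fin"
    using assms(2) unfolding admissible_iff by auto
  have "set_integrable lebesgue {0..m} v \<longleftrightarrow> set_integrable lebesgue {0..m} v1"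
    by (rule set_integrable_cong) (auto simp: v_def join_at_def)
  then have v_left: "set_integrable lebesgue {0..m} v"
    using 1(2) by simp
  have v_right: "set_integrable lebesgue {m..m + n} v"
  proof (rule absolutely_integrable_spike[OF _ negligible_sing])
    show "set_integrable lebesgue {m..m + n} (\<lambda>t. v2 (t - m))"
      using set_lebesgue_shift(1)[OF 2(2), of "- m"] by (simp add: add_ac)
    show "v t = v2 (t - m)" if "t \<in> {m..m + n} - {m}" for t
      using that by (simp add: v_def join_at_def)
  qed
  have Icc: "{0..m + n} = {0..m} \<union> {m..m + n}"
    using 1(1) 2(1) by auto
  have v_int: "set_integrable lebesgue {0..m + n} v"
    unfolding Icc using v_left v_right by (intro set_integrable_Un) auto
  have "absolutely_continuous_on {0..m} q"
    by (rule absolutely_continuous_on_contraction[OF 1(3)]) (auto simp: q_def join_at_def)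
  moreover have "absolutely_continuous_on {m..m + n} (\<lambda>t. q2 (t - m))"
    using absolutely_continuous_on_shift[OF 2(3), of "- m"] by (simp add: add_ac)
  then have "absolutely_continuous_on {m..m + n} q"
    by (rule absolutely_continuous_on_contraction) (auto simp: q_def join_at_def 1(6) 2(5))
  ultimately have q_ac: "absolutely_continuous_on {0..m + n} q"
    by (rule absolutely_continuous_on_glue) (use 1(1) 2(1) in auto)
  have "AE t in lebesgue. t \<in> {0..m + n} \<longrightarrow> follows_control q (v t) t {0..m + n}"
    using AE_lebesgue_neq[of 0] AE_lebesgue_neq[of m] AE_lebesgue_neq[of "m + n"] 1(4)
      AE_lebesgue_shift[OF 2(4), of "- m"]
  proof eventually_elim
    case (elim t)
    show ?case
    proof
      assume t: "t \<in> {0..m + n}"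
      have "follows_control q (v t) t UNIV"
      proof (cases "t < m")
        case True
        then have "follows_control q1 (v1 t) t UNIV"
          using elim t follows_control_interior[of 0 t m] by auto
        then show ?thesis
          using True follows_control_cong[of "{..<m}" t q q1] by (simp add: q_def v_def join_at_def)
      next
        case False
        then have "follows_control q2 (v2 (t + - m)) (t + - m) UNIV"
          using elim t follows_control_interior[of 0 "t + - m" n] by auto
        then have "follows_control (\<lambda>t. q2 (t + - m)) (v2 (t + - m)) t UNIV"
          by (rule follows_control_shift)
        then show ?thesis
          using False elim(2) follows_control_cong[of "{m<..}" t q "\<lambda>t. q2 (t + - m)"]
          by (simp add: q_def v_def join_at_def)
      qed
      then show "follows_control q (v t) t {0..m + n}"
        using elim t follows_control_interior[of 0 t "m + n"] by auto
    qed
  qed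
  moreover have "q 0 = q_in" "q (m + n) = q_fin"
    using 1 2 by (auto simp: q_def join_at_def)
  ultimately show "admissible q_in q_fin (m + n) (join_at m q1 q2) (join_at m v1 v2)"
    using v_int q_ac 1(1) 2(1) unfolding admissible_iff q_def v_def by auto
  have "cost \<xi> (m + n) v = cost \<xi> m v + cost \<xi> n (\<lambda>t. v (t + m))"
    using cost_split[OF v_int, of m] 1(1) 2(1) by simp
  also have "cost \<xi> m v = cost \<xi> m v1"
    unfolding cost_def by (rule set_lebesgue_integral_cong) (auto simp: v_def join_at_def)
  also have "cost \<xi> n (\<lambda>t. v (t + m)) = cost \<xi> n v2"
  proof -
    have v_tail: "set_integrable lebesgue {0..n} (\<lambda>t. v (t + m))"
      using set_lebesgue_shift(1)[OF v_right, of m] by simp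
    have "integral {0..n} (\<lambda>t. sqrt (\<xi>\<^sup>2 + (v (t + m))\<^sup>2)) = integral {0..n} (\<lambda>t. sqrt (\<xi>\<^sup>2 + (v2 t)\<^sup>2))"
      by (rule integral_spike[OF negligible_sing[of 0]]) (auto simp: v_def join_at_def)
    then show ?thesis
      unfolding cost_def
      using set_integrable_cost_density[OF v_tail] set_integrable_cost_density[OF 2(2)]
      by (simp add: set_lebesgue_integral_eq_integral)
  qed
  finally show "cost \<xi> (m + n) (join_at m v1 v2) = cost \<xi> m v1 + cost \<xi> n v2"
    by (simp add: v_def)
qed

section \<open>Minimizers\<close>

text \<open>
  A competitor towards \<open>q s\<close>, followed by the part of \<open>q\<close> after \<open>s\<close>, competes with \<open>q\<close> itself; the cost
  of that part cancels in the comparison.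
\<close>

lemma is_solution_head:
  assumes "is_solution \<xi> q_in q_fin l q v" "s \<in> {0..l}"
  shows "is_solution \<xi> q_in (q s) s q v"
proof -
  have adm: "admissible q_in q_fin l q v"
    using assms(1) unfolding is_solution_def by (rule conjunct1)
  have opt: "cost \<xi> l v \<le> cost \<xi> l' v'" if "admissible q_in q_fin l' q' v'" for l' q' v'
    using assms(1) that unfolding is_solution_def by metis
  have "cost \<xi> s v \<le> cost \<xi> l' v'" if adm': "admissible q_in (q s) l' q' v'" for l' q' v'
  proof -
    note replaced = admissible_concat[OF adm' admissible_tail[OF adm assms(2)]]
    have "cost \<xi> s v + cost \<xi> (l - s) (\<lambda>t. v (t + s)) = cost \<xi> l v"
      using adm cost_split[OF _ assms(2)] by (simp add: admissible_iff)
    also have "\<dots> \<le> cost \<xi> l' v' + cost \<xi> (l - s) (\<lambda>t. v (t + s))"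
      using opt[OF replaced(1)] replaced(2) by simp
    finally show ?thesis by simp
  qed
  with admissible_head[OF adm assms(2)] show ?thesis
    unfolding is_solution_def by blast
qed

text \<open>
  A minimizer from the origin to \<open>p\<close> never leaves the existence set, so it serves as the path.
\<close>

lemma path_component_origin:
  assumes "p \<in> existence_set \<xi>"
  shows "path_component (existence_set \<xi>) origin p"
proof -
  obtain l q v where sol: "is_solution \<xi> origin p l q v"
    using assms unfolding existence_set_def by blast
  then have l: "0 \<le> l" "absolutely_continuous_on {0..l} q" "q 0 = origin" "q l = p"
    unfolding is_solution_def admissible_iff by auto
  have "q ` {0..l} \<subseteq> existence_set \<xi>"
    using is_solution_head[OF sol] unfolding existence_set_def by blast
  moreover have "(\<lambda>t. l * t) ` {0..1} \<subseteq> {0..l}"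
    using l(1) by (auto simp: mult_left_le)
  moreover from this have "continuous_on {0..1} (\<lambda>t. q (l * t))"
    by (intro continuous_on_compose2[OF absolutely_continuous_on_imp_continuous_on[OF l(2)]] continuous_intros)
  ultimately show ?thesis
    unfolding path_component_def
    by (intro exI[of _ "\<lambda>t. q (l * t)"])
      (auto simp: path_def path_image_def pathstart_def pathfinish_def l(3,4))
qed

lemma admissible_displacement_le:
  assumes "admissible q_in q_fin l q v"
  shows "fst q_fin - fst q_in \<le> l"
proof -
  have q: "0 \<le> l" "absolutely_continuous_on {0..l} q"
    "AE t in lebesgue. t \<in> {0..l} \<longrightarrow> follows_control q (v t) t {0..l}" "q 0 = q_in" "q l = q_fin"
    using assms unfolding admissible_iff by auto
  have cos_le: "circle_cos \<theta> \<le> 1" for \<theta>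
    by transfer simp
  have "fst (q l) - fst (q 0) \<le> 1 * (l - 0)"
  proof (rule absolutely_continuous_on_increment_le)
    show "absolutely_continuous_on {0..l} (\<lambda>t. fst (q t))"
      by (rule absolutely_continuous_on_contraction[OF q(2)]) (rule dist_fst_le)
    show "AE t in lebesgue. t \<in> {0..l} \<longrightarrow>
        (\<exists>D\<le>1. ((\<lambda>t. fst (q t)) has_real_derivative D) (at t within {0..l}))"
      using q(3) by eventually_elim (use cos_le in \<open>auto simp: follows_control_def\<close>)
  qed (use q(1) in auto)
  then show ?thesis
    using q(4,5) by simp
qed

lemma cost_ge_length:
  assumes "0 \<le> \<xi>" "admissible q_in q_fin l q v"
  shows "\<xi> * l \<le> cost \<xi> l v"
proof -
  have l: "0 \<le> l" and v: "set_integrable lebesgue {0..l} v"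
    using assms(2) unfolding admissible_iff by auto
  have "\<xi> * l = (LINT s:{0..l}|lebesgue. \<xi>)"
    using l by (simp add: set_integral_const)
  also have "\<dots> \<le> cost \<xi> l v"
    unfolding cost_def
  proof (rule set_integral_mono)
    show "set_integrable lebesgue {0..l} (\<lambda>s. sqrt (\<xi>\<^sup>2 + (v s)\<^sup>2))"
      by (rule set_integrable_cost_density[OF v])
    show "\<xi> \<le> sqrt (\<xi>\<^sup>2 + (v s)\<^sup>2)" for s
      by (rule real_le_rsqrt) simp
  qed auto
  finally show ?thesis .
qed

text \<open>
  The straight segment attains the lower bound \<open>\<xi> * L\<close> that the two preceding lemmas impose on the
  cost of all its competitors.
\<close>

lemma is_solution_straight:
  assumes "0 \<le> \<xi>" "0 \<le> L"
  shows "is_solution \<xi> origin (L, 0, angle 0) L (\<lambda>s. (s, 0, angle 0)) (\<lambda>s. 0)"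
proof -
  have "follows_control (\<lambda>s. (s, 0, angle 0)) 0 s S" for s S
    unfolding follows_control_def has_angular_derivative_def
    by (auto simp: circle_cos.abs_eq circle_sin.abs_eq intro!: exI[of _ "\<lambda>_. 0"] derivative_eq_intros)
  moreover have "absolutely_continuous_on {0..L} (\<lambda>s. (s, 0 :: real, angle 0))"
  proof (rule absolutely_continuous_on_contraction)
    show "absolutely_continuous_on {0..L} (\<lambda>s. s)"
      unfolding absolutely_continuous_on_iff
    proof (intro allI impI)
      fix \<epsilon> :: real assume "\<epsilon> > 0"
      have "(\<Sum>(a, b)\<in>D. dist a b) = (\<Sum>(a, b)\<in>D. b - a)" if "disjoint_segments {0..L} D" for D
        using that by (intro sum.cong) (auto simp: disjoint_segments_def dist_real_def)
      with \<open>\<epsilon> > 0\<close> show "\<exists>\<delta>>0. \<forall>D. disjoint_segments {0..L} D \<and> (\<Sum>(a, b)\<in>D. b - a) < \<delta> \<longrightarrow>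
          (\<Sum>(a, b)\<in>D. dist a b) < \<epsilon>"
        by (intro exI[of _ \<epsilon>]) auto
    qed
  qed (simp add: dist_Pair_Pair)
  ultimately have "admissible origin (L, 0, angle 0) L (\<lambda>s. (s, 0, angle 0)) (\<lambda>s. 0)"
    using assms(2) unfolding admissible_iff origin_def set_integrable_def by simp
  moreover have "cost \<xi> L (\<lambda>s. 0) \<le> cost \<xi> l v" if adm: "admissible origin (L, 0, angle 0) l q v" for l q v
  proof -
    have "cost \<xi> L (\<lambda>s. 0) = \<xi> * L"
      using assms by (simp add: cost_def set_integral_const)
    also have "\<dots> \<le> \<xi> * l"
      using admissible_displacement_le[OF adm] assms(1) by (simp add: origin_def mult_left_mono)
    also have "\<dots> \<le> cost \<xi> l v"
      by (rule cost_ge_length[OF assms(1) adm])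
    finally show ?thesis .
  qed
  ultimately show ?thesis
    unfolding is_solution_def by blast
qed

theorem proposition32:
  fixes \<xi> :: real
  assumes "\<xi> > 0"
  shows "path_connected (existence_set \<xi>) \<and> \<not> compact (existence_set \<xi>)"
proof
  show "path_connected (existence_set \<xi>)"
    unfolding path_connected_component
    using path_component_origin path_component_sym path_component_trans by blast
  have "(L, 0, angle 0) \<in> existence_set \<xi>" if "0 \<le> L" for L
    using is_solution_straight[OF _ that] assms unfolding existence_set_def
    by (metis (mono_tags) less_imp_le mem_Collect_eq)
  then have "{0..} \<subseteq> fst ` existence_set \<xi>"
    by force
  moreover have "\<not> bounded {0 :: real..}"
  proof
    assume "bounded {0 :: real..}"
    then obtain b where "\<And>x :: real. 0 \<le> x \<Longrightarrow> norm x \<le> b"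
      unfolding bounded_iff by auto
    from this[of "\<bar>b\<bar> + 1"] show False
      by simp
  qed
  ultimately show "\<not> compact (existence_set \<xi>)"
    using bounded_subset bounded_fst compact_imp_bounded by blast
qed

end
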